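(* Let $(G,\cdot)$ be a Smarandache loop with an S-subgroup $(H,\cdot)$. A mapping $\theta\in SYM(G,\cdot)$ is an S-special map for $G$ if and only if $\theta$ is an S-isomorphism of $(G,\cdot)$ onto some Smarandache $f,g$-principal isotope $(G,\circ)$ with $f,g\in H$.
   Context: A loop is a quasigroup with two-sided identity $e$. A Smarandache loop (S-loop) is a loop $(G,\cdot)$ having a subset $H$ such that $(H,\cdot)$ is a non-trivial subgroup (a subloop that is a group, $\{e\}\ne H\ne G$); $H$ is called an S-subgroup. Maps are written on the right and composed left to right. $SYM(G,\cdot)$ is the group of all bijections of $G$; $yL_x=x\cdot y$, $yR_x=y\cdot x$. $AUT(G,\cdot)$ is the group of autotopisms, i.e. triples $(U,V,W)\in SYM(G)^3$ with $xU\cdot yV=(x\cdot y)W$ for all $x,y\in G$. $SSYM(G,\cdot)$ consists of all $\theta\in SYM(G,\cdot)$ with $h\theta\in H$ for all $h\in H$. $\theta$ is an S-special map if $\theta\in SSYM(G,\cdot)$ and there exist $f,g\in H$ with $(\theta R_g^{-1},\theta L_f^{-1},\theta)\in AUT(G,\cdot)$. For $f,g\in H$, the Smarandache $f,g$-principal isotope $(G,\circ)$ of $(G,\cdot)$ is given by $x\circ y=xR_g^{-1}\cdot yL_f^{-1}$; it is an S-loop with S-subgroup $(H,\circ)$. For S-loops $(L,\cdot)$, $(K,\circ)$ with S-subgroups $L'$, $K'$, an S-isomorphism is a loop isomorphism $A:(L,\cdot)\to(K,\circ)$ with $xA\in K'$ for all $x\in L'$; here $L'=(H,\cdot)$ and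 $K'=(H,\circ)$. *)

theory Defs
  imports "HOL-Algebra.Bij"
begin

locale quasigroup =
  fixes G (structure)
  assumes m_closed: "\<lbrakk>x \<in> carrier G; y \<in> carrier G\<rbrakk> \<Longrightarrow> x \<otimes> y \<in> carrier G"
    and left_division: "\<lbrakk>a \<in> carrier G; b \<in> carrier G\<rbrakk> \<Longrightarrow> \<exists>!x. x \<in> carrier G \<and> a \<otimes> x = b"
    and right_division: "\<lbrakk>a \<in> carrier G; b \<in> carrier G\<rbrakk> \<Longrightarrow> \<exists>!y. y \<in> carrier G \<and> y \<otimes> a = b"

locale loop = quasigroup +
  assumes one_closed: "\<one> \<in> carrier G"
    and l_one: "x \<in> carrier G \<Longrightarrow> \<one> \<otimes> x = x"
    and r_one: "x \<in> carrier G \<Longrightarrow> x \<otimes> \<one> = x"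

definition subloop :: "'a set \<Rightarrow> ('a, 'b) monoid_scheme \<Rightarrow> bool" where
  "subloop H G \<longleftrightarrow> H \<subseteq> carrier G \<and> loop (G\<lparr>carrier := H\<rparr>)"

definition S_subgroup :: "'a set \<Rightarrow> ('a, 'b) monoid_scheme \<Rightarrow> bool" where
  "S_subgroup H G \<longleftrightarrow>
     subloop H G \<and> group (G\<lparr>carrier := H\<rparr>) \<and> H \<noteq> {\<one>\<^bsub>G\<^esub>} \<and> H \<noteq> carrier G"

definition S_loop :: "('a, 'b) monoid_scheme \<Rightarrow> bool" where
  "S_loop G \<longleftrightarrow> loop G \<and> (\<exists>H. S_subgroup H G)"

(* Elements of Bij are extensional: each stands for exactly one map of the carrier
   to itself.  Maps are written on the left here, so a product U V that applies U
   first becomes compose (carrier G) V U. *)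
definition SYM :: "('a, 'b) monoid_scheme \<Rightarrow> ('a \<Rightarrow> 'a) set" where
  "SYM G = Bij (carrier G)"

definition L_map :: "('a, 'b) monoid_scheme \<Rightarrow> 'a \<Rightarrow> 'a \<Rightarrow> 'a" where
  "L_map G x = (\<lambda>y\<in>carrier G. x \<otimes>\<^bsub>G\<^esub> y)"

definition R_map :: "('a, 'b) monoid_scheme \<Rightarrow> 'a \<Rightarrow> 'a \<Rightarrow> 'a" where
  "R_map G x = (\<lambda>y\<in>carrier G. y \<otimes>\<^bsub>G\<^esub> x)"

definition L_inv :: "('a, 'b) monoid_scheme \<Rightarrow> 'a \<Rightarrow> 'a \<Rightarrow> 'a" where
  "L_inv G x = restrict (inv_into (carrier G) (L_map G x)) (carrier G)"

definition R_inv :: "('a, 'b) monoid_scheme \<Rightarrow> 'a \<Rightarrow> 'a \<Rightarrow> 'a" where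
  "R_inv G x = restrict (inv_into (carrier G) (R_map G x)) (carrier G)"

definition AUT :: "('a, 'b) monoid_scheme \<Rightarrow> (('a \<Rightarrow> 'a) \<times> ('a \<Rightarrow> 'a) \<times> ('a \<Rightarrow> 'a)) set" where
  "AUT G = {(U, V, W). U \<in> SYM G \<and> V \<in> SYM G \<and> W \<in> SYM G \<and>
     (\<forall>x\<in>carrier G. \<forall>y\<in>carrier G. U x \<otimes>\<^bsub>G\<^esub> V y = W (x \<otimes>\<^bsub>G\<^esub> y))}"

definition SSYM :: "('a, 'b) monoid_scheme \<Rightarrow> 'a set \<Rightarrow> ('a \<Rightarrow> 'a) set" where
  "SSYM G H = {\<theta> \<in> SYM G. \<forall>h\<in>H. \<theta> h \<in> H}"

definition S_special_map :: "('a, 'b) monoid_scheme \<Rightarrow> 'a set \<Rightarrow> ('a \<Rightarrow> 'a) \<Rightarrow> bool" where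
  "S_special_map G H \<theta> \<longleftrightarrow> \<theta> \<in> SSYM G H \<and>
     (\<exists>f\<in>H. \<exists>g\<in>H.
        (compose (carrier G) (R_inv G g) \<theta>, compose (carrier G) (L_inv G f) \<theta>, \<theta>) \<in> AUT G)"

(* The identity element of the f,g-principal isotope is f \<otimes> g, not the identity of G. *)
definition principal_isotope ::
    "('a, 'b) monoid_scheme \<Rightarrow> 'a \<Rightarrow> 'a \<Rightarrow> ('a, 'b) monoid_scheme" where
  "principal_isotope G f g =
     G\<lparr>mult := (\<lambda>x y. R_inv G g x \<otimes>\<^bsub>G\<^esub> L_inv G f y), one := f \<otimes>\<^bsub>G\<^esub> g\<rparr>"

(* The isomorphisms of HOL-Algebra are the bijections between the carriers that
   preserve multiplication, and preserving the identity is automatic for loops.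
   Preservation of the S-subgroups is required in one direction only. *)
definition S_isomorphism ::
    "('a, 'c) monoid_scheme \<Rightarrow> 'a set \<Rightarrow> ('b, 'd) monoid_scheme \<Rightarrow> 'b set \<Rightarrow> ('a \<Rightarrow> 'b) \<Rightarrow> bool" where
  "S_isomorphism L L' K K' A \<longleftrightarrow>
     S_loop L \<and> S_subgroup L' L \<and> S_loop K \<and> S_subgroup K' K \<and>
     A \<in> iso L K \<and> (\<forall>x\<in>L'. A x \<in> K')"

end

theory Submission
  imports Defs
begin

text \<open>
  The autotopism condition for \<open>(\<theta>R\<^sub>g\<^sup>-\<^sup>1, \<theta>L\<^sub>f\<^sup>-\<^sup>1, \<theta>)\<close> says literally that \<open>\<theta>\<close> is a homomorphism
  onto the \<open>f,g\<close>-principal isotope, so the content is that this isotope is an S-loop with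
  S-subgroup \<open>H\<close>. On \<open>H\<close> the divisions of \<open>G\<close> agree with those of the group \<open>H\<close>, hence
  \<open>x \<circ> y = x \<cdot> (g\<^sup>-\<^sup>1 \<cdot> f\<^sup>-\<^sup>1) \<cdot> y\<close> there, and this operation makes \<open>H\<close> a group with identity \<open>f \<cdot> g\<close>.
\<close>

text \<open>\<open>S_subgroup\<close> asks for a loop structure besides the group structure; this
  derives the former from the latter.\<close>

lemma (in group) loop: "loop G"
proof
  fix a b assume ab: "a \<in> carrier G" "b \<in> carrier G"
  show "\<exists>!x. x \<in> carrier G \<and> a \<otimes> x = b"
    by (rule ex1I[of _ "inv a \<otimes> b"]) (use ab in \<open>auto simp: m_assoc[symmetric]\<close>)
  show "\<exists>!y. y \<in> carrier G \<and> y \<otimes> a = b"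
    by (rule ex1I[of _ "b \<otimes> inv a"]) (use ab in \<open>auto simp: m_assoc\<close>)
qed auto

text \<open>Right translation by \<open>c\<close> turns the new product into the old one: \<open>(x
  \<otimes> c \<otimes> y) \<otimes> c = (x \<otimes> c) \<otimes> (y \<otimes> c)\<close>.\<close>

lemma (in group) sandwich_group:
  assumes c: "c \<in> carrier G"
  shows "group (G\<lparr>mult := (\<lambda>x y. x \<otimes> c \<otimes> y), one := inv c\<rparr>)"
proof (rule groupI)
  fix x assume "x \<in> carrier (G\<lparr>mult := (\<lambda>x y. x \<otimes> c \<otimes> y), one := inv c\<rparr>)"
  with c show "\<exists>y\<in>carrier (G\<lparr>mult := (\<lambda>x y. x \<otimes> c \<otimes> y), one := inv c\<rparr>).
      y \<otimes>\<^bsub>G\<lparr>mult := (\<lambda>x y. x \<otimes> c \<otimes> y), one := inv c\<rparr>\<^esub> x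
        = \<one>\<^bsub>G\<lparr>mult := (\<lambda>x y. x \<otimes> c \<otimes> y), one := inv c\<rparr>\<^esub>"
    \<comment> \<open>The witness solves \<open>y \<otimes> c \<otimes> x = inv c\<close> for
      \<open>y\<close>.\<close>
    by (intro bexI[of _ "inv c \<otimes> inv x \<otimes> inv c"]) (auto simp: m_assoc)
qed (use c in \<open>auto simp: m_assoc\<close>)

text \<open>Needed because the isotope product and the sandwich product are compared only on
  \<open>H\<close>; as functions on the whole type they may differ.\<close>

lemma group_cong:
  assumes "group K" and "carrier K' = carrier K" and "\<one>\<^bsub>K'\<^esub> = \<one>\<^bsub>K\<^esub>"
    and "\<And>x y. \<lbrakk>x \<in> carrier K; y \<in> carrier K\<rbrakk> \<Longrightarrow> x \<otimes>\<^bsub>K'\<^esub> y = x \<otimes>\<^bsub>K\<^esub> y"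
  shows "group K'"
proof -
  interpret K: group K by fact
  show ?thesis
    by (rule groupI) (use assms(2-) K.l_inv_ex in \<open>auto simp: K.m_assoc\<close>)
qed

context quasigroup
begin

lemma L_map_Bij: "a \<in> carrier G \<Longrightarrow> L_map G a \<in> Bij (carrier G)"
  using left_division[of a] m_closed[of a]
  unfolding Bij_def L_map_def bij_betw_def inj_on_def by (auto simp: image_iff) metis+

lemma R_map_Bij: "a \<in> carrier G \<Longrightarrow> R_map G a \<in> Bij (carrier G)"
  using right_division[of a] m_closed[of _ a]
  unfolding Bij_def R_map_def bij_betw_def inj_on_def by (auto simp: image_iff) metis+

lemma L_inv_Bij: "a \<in> carrier G \<Longrightarrow> L_inv G a \<in> Bij (carrier G)"
  using restrict_inv_into_Bij[OF L_map_Bij] by (simp add: L_inv_def)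

lemma R_inv_Bij: "a \<in> carrier G \<Longrightarrow> R_inv G a \<in> Bij (carrier G)"
  using restrict_inv_into_Bij[OF R_map_Bij] by (simp add: R_inv_def)

text \<open>By injectivity of the translation, any solution of the equation is the value of the
  division. Later computations rest on this rule and its mirror image instead of
  \<open>inv_into\<close>.\<close>

lemma L_inv_eqI: "\<lbrakk>a \<in> carrier G; x \<in> carrier G; a \<otimes> x = y\<rbrakk> \<Longrightarrow> L_inv G a y = x"
  using L_map_Bij[of a] m_closed[of a x] unfolding L_inv_def
  by (auto simp: Bij_def bij_betw_def L_map_def intro!: inv_into_f_eq)

lemma R_inv_eqI: "\<lbrakk>a \<in> carrier G; x \<in> carrier G; x \<otimes> a = y\<rbrakk> \<Longrightarrow> R_inv G a y = x"
  using R_map_Bij[of a] m_closed[of x a] unfolding R_inv_def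
  by (auto simp: Bij_def bij_betw_def R_map_def intro!: inv_into_f_eq)

lemma L_inv_closed: "\<lbrakk>a \<in> carrier G; y \<in> carrier G\<rbrakk> \<Longrightarrow> L_inv G a y \<in> carrier G"
  using L_inv_Bij Bij_imp_funcset by blast

lemma R_inv_closed: "\<lbrakk>a \<in> carrier G; y \<in> carrier G\<rbrakk> \<Longrightarrow> R_inv G a y \<in> carrier G"
  using R_inv_Bij Bij_imp_funcset by blast

lemma mult_L_inv: "\<lbrakk>a \<in> carrier G; y \<in> carrier G\<rbrakk> \<Longrightarrow> a \<otimes> L_inv G a y = y"
  using left_division[of a y] L_inv_eqI by metis

lemma R_inv_mult: "\<lbrakk>a \<in> carrier G; y \<in> carrier G\<rbrakk> \<Longrightarrow> R_inv G a y \<otimes> a = y"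
  using right_division[of a y] R_inv_eqI by metis

text \<open>The isotope product is the old one with a bijection applied to each argument first, so
  unique solvability carries over.\<close>

lemma principal_isotope_loop:
  assumes f: "f \<in> carrier G" and g: "g \<in> carrier G"
  shows "loop (principal_isotope G f g)"
proof
  fix a b assume "a \<in> carrier (principal_isotope G f g)" "b \<in> carrier (principal_isotope G f g)"
  then have a: "a \<in> carrier G" and b: "b \<in> carrier G"
    by (auto simp: principal_isotope_def)
  show "a \<otimes>\<^bsub>principal_isotope G f g\<^esub> b \<in> carrier (principal_isotope G f g)"
    using f g a b by (simp add: principal_isotope_def m_closed L_inv_closed R_inv_closed)
  have "\<exists>!x. x \<in> carrier G \<and> R_inv G g a \<otimes> L_inv G f x = b"
  proof -
    obtain u where u: "u \<in> carrier G" "R_inv G g a \<otimes> u = b"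
      and uniq: "\<And>v. \<lbrakk>v \<in> carrier G; R_inv G g a \<otimes> v = b\<rbrakk> \<Longrightarrow> v = u"
      using left_division[OF R_inv_closed[OF g a] b] by metis
    show ?thesis
    \<comment> \<open>The quotient \<open>u\<close> must equal \<open>L_inv G f x\<close>, which
      forces \<open>x = f \<otimes> u\<close>.\<close>
    proof (rule ex1I[of _ "f \<otimes> u"])
      show "f \<otimes> u \<in> carrier G \<and> R_inv G g a \<otimes> L_inv G f (f \<otimes> u) = b"
        using f u L_inv_eqI m_closed by simp
    next
      fix x assume "x \<in> carrier G \<and> R_inv G g a \<otimes> L_inv G f x = b"
      then show "x = f \<otimes> u"
        using f uniq L_inv_closed mult_L_inv by metis
    qed
  qed
  then show "\<exists>!x. x \<in> carrier (principal_isotope G f g) \<and> a \<otimes>\<^bsub>principal_isotope G f g\<^esub> x = b"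
    by (simp add: principal_isotope_def)
  have "\<exists>!y. y \<in> carrier G \<and> R_inv G g y \<otimes> L_inv G f a = b"
  proof -
    obtain u where u: "u \<in> carrier G" "u \<otimes> L_inv G f a = b"
      and uniq: "\<And>v. \<lbrakk>v \<in> carrier G; v \<otimes> L_inv G f a = b\<rbrakk> \<Longrightarrow> v = u"
      using right_division[OF L_inv_closed[OF f a] b] by metis
    show ?thesis
    proof (rule ex1I[of _ "u \<otimes> g"])
      show "u \<otimes> g \<in> carrier G \<and> R_inv G g (u \<otimes> g) \<otimes> L_inv G f a = b"
        using g u R_inv_eqI m_closed by simp
    next
      fix x assume "x \<in> carrier G \<and> R_inv G g x \<otimes> L_inv G f a = b"
      then show "x = u \<otimes> g"
        using g uniq R_inv_closed R_inv_mult by metis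
    qed
  qed
  then show "\<exists>!y. y \<in> carrier (principal_isotope G f g) \<and> y \<otimes>\<^bsub>principal_isotope G f g\<^esub> a = b"
    by (simp add: principal_isotope_def)
\<comment> \<open>The identity laws remain: \<open>R_inv G g\<close> sends
  \<open>f \<otimes> g\<close> to \<open>f\<close>, and multiplying by \<open>f\<close> undoes
  \<open>L_inv G f\<close>; dually on the other side.\<close>
qed (use f g in \<open>auto simp: principal_isotope_def m_closed mult_L_inv R_inv_mult
       L_inv_eqI[OF f g refl] R_inv_eqI[OF g f refl]\<close>)

lemma principal_isotope_S_subgroup:
  assumes H: "S_subgroup H G" and f: "f \<in> H" and g: "g \<in> H"
  shows "S_subgroup H (principal_isotope G f g)"
proof -
  define K where "K = G\<lparr>carrier := H\<rparr>"
  interpret K: group K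
    using H by (simp add: K_def S_subgroup_def)
  have sub: "H \<subseteq> carrier G" and ne: "H \<noteq> {\<one>}" "H \<noteq> carrier G"
    using H by (auto simp: S_subgroup_def subloop_def)
  have [simp]: "carrier K = H" "mult K = mult G" "\<one>\<^bsub>K\<^esub> = \<one>"
    by (simp_all add: K_def)
  note Hs = K.m_closed[simplified] K.inv_closed[simplified] K.l_inv[simplified]
    K.r_inv[simplified] K.m_assoc[simplified] K.l_one[simplified] K.r_one[simplified]
  \<comment> \<open>The solution found inside the group \<open>H\<close> is also the division in
    \<open>G\<close>, since the latter is unique.\<close>
  have R: "R_inv G g x = x \<otimes> inv\<^bsub>K\<^esub> g" if "x \<in> H" for x
    by (rule R_inv_eqI) (use that f g sub Hs in auto)
  have L: "L_inv G f y = inv\<^bsub>K\<^esub> f \<otimes> y" if "y \<in> H" for y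
    by (rule L_inv_eqI)
      (use that f g sub Hs in \<open>auto simp: K.m_assoc[simplified, symmetric]\<close>)
  \<comment> \<open>On \<open>H\<close> the isotope product is
    \<open>x \<otimes> c \<otimes> y\<close>, and the inverse of \<open>c\<close> is the isotope
    identity \<open>f \<otimes> g\<close>.\<close>
  define c where "c = inv\<^bsub>K\<^esub> g \<otimes> inv\<^bsub>K\<^esub> f"
  have c: "c \<in> H"
    using f g Hs by (simp add: c_def)
  have inv_c: "inv\<^bsub>K\<^esub> c = f \<otimes> g"
    using f g K.inv_mult_group[of "inv\<^bsub>K\<^esub> g" "inv\<^bsub>K\<^esub> f"] by (simp add: c_def Hs)
  have "group (K\<lparr>mult := (\<lambda>x y. x \<otimes>\<^bsub>K\<^esub> c \<otimes>\<^bsub>K\<^esub> y), one := inv\<^bsub>K\<^esub> c\<rparr>)"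
    using c by (intro K.sandwich_group) simp
  then have grp: "group (principal_isotope G f g\<lparr>carrier := H\<rparr>)"
    by (rule group_cong)
      (use f g in \<open>auto simp: principal_isotope_def R L inv_c[unfolded c_def] c_def Hs\<close>)
  \<comment> \<open>Nontriviality must be rechecked against the new identity: a singleton
    \<open>H\<close> would be \<open>{\<one>}\<close>, as it contains \<open>\<one>\<close>.\<close>
  have "H \<noteq> {f \<otimes> g}"
    using ne K.one_closed by auto
  then show ?thesis
    using grp group.loop[OF grp] sub ne
    by (auto simp: S_subgroup_def subloop_def principal_isotope_def)
qed

end

text \<open>Both sides reduce to \<open>R_inv G g (\<theta> x) \<otimes> L_inv G f (\<theta> y) =
  \<theta> (x \<otimes> y)\<close>; bijectivity of all three components follows from that of
  \<open>\<theta>\<close> and of the divisions.\<close>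

lemma compose_AUT_iff_iso:
  assumes "quasigroup G" and f: "f \<in> carrier G" and g: "g \<in> carrier G" and \<theta>: "\<theta> \<in> SYM G"
  shows "(compose (carrier G) (R_inv G g) \<theta>, compose (carrier G) (L_inv G f) \<theta>, \<theta>) \<in> AUT G
    \<longleftrightarrow> \<theta> \<in> iso G (principal_isotope G f g)"
proof -
  interpret quasigroup G by fact
  have "bij_betw \<theta> (carrier G) (carrier G)" "\<theta> \<in> carrier G \<rightarrow> carrier G"
    using \<theta> by (auto simp: SYM_def Bij_def bij_betw_def)
  moreover have "compose (carrier G) (R_inv G g) \<theta> \<in> SYM G" "compose (carrier G) (L_inv G f) \<theta> \<in> SYM G"
    using f g \<theta> by (auto simp: SYM_def compose_Bij L_inv_Bij R_inv_Bij)
  ultimately show ?thesis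
    using \<theta> by (auto simp: AUT_def iso_def hom_def principal_isotope_def compose_eq)
qed

theorem theorem3p3:
  fixes G :: "('a, 'b) monoid_scheme" and H :: "'a set" and \<theta> :: "'a \<Rightarrow> 'a"
  assumes "S_loop G" and "S_subgroup H G" and "\<theta> \<in> SYM G"
  shows "S_special_map G H \<theta> \<longleftrightarrow>
    (\<exists>f\<in>H. \<exists>g\<in>H. S_isomorphism G H (principal_isotope G f g) H \<theta>)"
proof -
  interpret loop G
    using assms(1) by (simp add: S_loop_def)
  have sub: "H \<subseteq> carrier G"
    using assms(2) by (simp add: S_subgroup_def subloop_def)
  \<comment> \<open>The equivalence holds for each fixed pair, so the same \<open>f\<close> and
    \<open>g\<close> serve as witnesses in both directions.\<close>
  have "S_isomorphism G H (principal_isotope G f g) H \<theta> \<longleftrightarrow> (\<forall>h\<in>H. \<theta> h \<in> H) \<and>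
      (compose (carrier G) (R_inv G g) \<theta>, compose (carrier G) (L_inv G f) \<theta>, \<theta>) \<in> AUT G"
    if fg: "f \<in> H" "g \<in> H" for f g
  proof -
    have fg': "f \<in> carrier G" "g \<in> carrier G"
      using fg sub by auto
    show ?thesis
      using assms principal_isotope_S_subgroup[OF assms(2) fg] principal_isotope_loop[OF fg']
        compose_AUT_iff_iso[OF quasigroup_axioms fg' assms(3)]
      by (auto simp: S_isomorphism_def S_loop_def)
  qed
  then show ?thesis
    using assms(3) by (auto simp: S_special_map_def SSYM_def)
qed

end
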